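(* Consider a model that is split into submodels. Assume that the corrections are applied such that all submodels are corrected to the first order at $u_k$. Then the updated model (the network of all corrected submodels) is correct to the first order at $u_k$, i.e. its predicted outputs and their gradients with respect to $u$ at $u_k$ equal those of the plant.
   Context: Plant $y_p=f_p(u)$ and model $y=f(u)$, with inputs $u\in\mathbb{R}^{n_u}$ and outputs $y\in\mathbb{R}^{n_y}$, all functions being differentiable as needed. The model is represented as a network of $n_{SM}$ submodels (SMs): submodel $i$ is a function $y^{(i)}=f^{(i)}(z^{(i)})$ whose outputs $y^{(i)}$ are part of $y$ and whose inputs are $z^{(i)}=[u^{(i)T},y^{(1,i)T},\dots,y^{(n_{SM},i)T}]^{T}$, where $u^{(i)}$ is the subset of $u$ entering submodel $i$ and $y^{(\ell,i)}$ the outputs of submodel $\ell$ that are inputs of submodel $i$ (series, parallel and feedback connections are allowed). Together the $y^{(i)}$ make up $y$; the network is solved for $y$ given $u$. The plant is described by functions $z_p^{(i)}=h_p^{(i)}(u)$ giving the plant values of the variables $z^{(i)}$ (extracted from $u$ and $f_p(u)$) and $y_p^{(i)}=f_p^{A(i)}(u)$ giving the plant values of $y^{(i)}$. Put $z_{p,k}^{(i)}=h_p^{(i)}(u_k)$. Each submodel $i$ is corrected by a function added to its output, with one of two structures (not necessarily the same for all submodels): Structure A: the corrected submodel is $f^{(i)}(z^{(i)})+\mu_k^{A(i)}(u)$; it is corrected to the first order at $u_k$ if $$f^{(i)}(z_{p,k}^{(i)})+\mu_k^{A(i)}(u_k)=f_p^{A(i)}(u_k),\qquad \nabla_{z^{(i)}}f^{(i)}|_{z_{p,k}^{(i)}}\nabla_uh_p^{(i)}|_{u_k}+\nabla_u\mu_k^{A(i)}|_{u_k}=\nabla_uf_p^{A(i)}|_{u_k}.$$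 Structure B: the corrected submodel is $f^{(i)}(z^{(i)})+\mu_k^{B(i)}(z^{(i)})$, and the plant is assumed to admit a function $f_p^{B(i)}$ with $y_p^{(i)}=f_p^{B(i)}(z_p^{(i)})$ (model consistency); it is corrected to the first order at $u_k$ if $$f^{(i)}(z_{p,k}^{(i)})+\mu_k^{B(i)}(z_{p,k}^{(i)})=f_p^{B(i)}(z_{p,k}^{(i)}),\qquad \big(\nabla_{z^{(i)}}f^{(i)}|_{z_{p,k}^{(i)}}+\nabla_{z^{(i)}}\mu_k^{B(i)}|_{z_{p,k}^{(i)}}\big)\nabla_uh_p^{(i)}|_{u_k}=\nabla_{z^{(i)}}f_p^{B(i)}|_{z_{p,k}^{(i)}}\nabla_uh_p^{(i)}|_{u_k}.$$
   Formalization: With feedback the claim can fail (y=y-y^3+u^3, plant 2u, u_k=0), so it is also assumed that the corrected network's equations are regular at u_k: the identity minus the Jacobian of the stacked corrected submodels in y is invertible (automatic without feedback). *)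

theory Defs
  imports "HOL-Analysis.Analysis"
begin

text \<open>
  Submodel \<open>i\<close> has inputs \<open>z\<close> and outputs \<open>y\<close> whose dimensions depend on \<open>i\<close>. Inputs are entries of
  the concatenated vector \<open>[u; y]\<close>, whose index type is \<open>'u + 'y\<close>. The index set \<open>Z i\<close> says which of
  these entries form the input of submodel \<open>i\<close>, and \<open>Y i\<close> which entries of \<open>y\<close> form its output. A
  vector indexed by a subset \<open>S\<close> is represented by the vector of full length that is zero outside \<open>S\<close>.
\<close>

type_synonym ('u, 'y) io_vec = "real ^ ('u + 'y)"

definition restrict_coords :: "'n set \<Rightarrow> real ^ 'n \<Rightarrow> real ^ 'n" where
  "restrict_coords S v = (\<chi> j. if j \<in> S then v $ j else 0)"

definition concat_vec :: "real ^ 'u \<Rightarrow> real ^ 'y \<Rightarrow> ('u, 'y) io_vec" where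
  "concat_vec u y = (\<chi> j. case j of Inl a \<Rightarrow> u $ a | Inr b \<Rightarrow> y $ b)"

definition sub_input :: "('u + 'y) set \<Rightarrow> real ^ 'u \<Rightarrow> real ^ 'y \<Rightarrow> ('u, 'y) io_vec" where
  "sub_input Zi u y = restrict_coords Zi (concat_vec u y)"

text \<open>
  A map from the variables in \<open>S\<close> to the variables in \<open>T\<close>: it ignores the entries outside \<open>S\<close>, and its
  value vanishes outside \<open>T\<close>. Its Jacobian is then the Jacobian of the underlying map, padded with zero
  rows and columns, so products of such Jacobians are the products of the underlying ones.
\<close>

definition coord_map :: "'m set \<Rightarrow> 'n set \<Rightarrow> (real ^ 'm \<Rightarrow> real ^ 'n) \<Rightarrow> bool" where
  "coord_map S T g \<longleftrightarrow> (\<forall>x. g (restrict_coords S x) = g x) \<and> (\<forall>x. restrict_coords T (g x) = g x)"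

abbreviation nabla :: "(real ^ 'm \<Rightarrow> real ^ 'n) \<Rightarrow> real ^ 'm \<Rightarrow> real ^ 'm ^ 'n" where
  "nabla g x \<equiv> jacobian g (at x)"

text \<open>
  A network is given by the index sets and by maps \<open>G i u z\<close> for the outputs of the submodels. The direct
  argument \<open>u\<close> besides \<open>z\<close> is there for corrections of structure A, which may depend on all of \<open>u\<close>.
\<close>

definition network_eqs ::
  "('s \<Rightarrow> 'y set) \<Rightarrow> ('s \<Rightarrow> ('u + 'y) set) \<Rightarrow> ('s \<Rightarrow> real ^ 'u \<Rightarrow> ('u, 'y) io_vec \<Rightarrow> real ^ 'y)
    \<Rightarrow> real ^ 'u \<Rightarrow> real ^ 'y \<Rightarrow> bool" where
  "network_eqs Y Z G u y \<longleftrightarrow> (\<forall>i. restrict_coords (Y i) y = G i u (sub_input (Z i) u y))"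

definition network_solution ::
  "(real ^ 'u) set \<Rightarrow> ('s \<Rightarrow> 'y set) \<Rightarrow> ('s \<Rightarrow> ('u + 'y) set)
    \<Rightarrow> ('s \<Rightarrow> real ^ 'u \<Rightarrow> ('u, 'y) io_vec \<Rightarrow> real ^ 'y) \<Rightarrow> (real ^ 'u \<Rightarrow> real ^ 'y) \<Rightarrow> bool" where
  "network_solution U Y Z G g \<longleftrightarrow> (\<forall>u\<in>U. \<forall>y. network_eqs Y Z G u y \<longleftrightarrow> y = g u)"

text \<open>
  Regularity of the network equations, as in the implicit function theorem. When the output index sets
  partition the outputs, the sum over \<open>i\<close> stacks the submodel outputs into one vector. Without feedback
  the condition always holds, since the Jacobian of the sum is then nilpotent. With feedback, unique
  solvability and differentiability of the solution do not imply it, and they alone do not determine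
  the gradient of the solution: \<open>y = (y - y ^ 3) + u ^ 3\<close> has the unique solution \<open>y = u\<close>, but its
  linearization at \<open>0\<close> is \<open>dy = dy\<close>.
\<close>

definition network_regular ::
  "('s::finite \<Rightarrow> ('u + 'y) set) \<Rightarrow> ('s \<Rightarrow> real ^ 'u \<Rightarrow> ('u, 'y) io_vec \<Rightarrow> real ^ 'y)
    \<Rightarrow> real ^ 'u \<Rightarrow> real ^ 'y \<Rightarrow> bool" where
  "network_regular Z G u y \<longleftrightarrow>
     invertible (nabla (\<lambda>y'. y' - (\<Sum>i\<in>UNIV. G i u (sub_input (Z i) u y'))) y)"

definition plant_input :: "('u + 'y) set \<Rightarrow> (real ^ 'u \<Rightarrow> real ^ 'y) \<Rightarrow> real ^ 'u \<Rightarrow> ('u, 'y) io_vec" where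
  "plant_input Zi f\<^sub>p u = sub_input Zi u (f\<^sub>p u)"

definition plant_output :: "'y set \<Rightarrow> (real ^ 'u \<Rightarrow> real ^ 'y) \<Rightarrow> real ^ 'u \<Rightarrow> real ^ 'y" where
  "plant_output Yi f\<^sub>p u = restrict_coords Yi (f\<^sub>p u)"

datatype ('u::finite, 'y::finite) correction =
  Structure_A "real ^ 'u \<Rightarrow> real ^ 'y"
| Structure_B "('u, 'y) io_vec \<Rightarrow> real ^ 'y"

primrec corrected ::
  "(('u::finite, 'y::finite) io_vec \<Rightarrow> real ^ 'y) \<Rightarrow> ('u, 'y) correction
    \<Rightarrow> real ^ 'u \<Rightarrow> ('u, 'y) io_vec \<Rightarrow> real ^ 'y" where
  "corrected fi (Structure_A \<mu>) = (\<lambda>u z. fi z + \<mu> u)"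
| "corrected fi (Structure_B \<mu>) = (\<lambda>u z. fi z + \<mu> z)"

text \<open>
  Standing assumptions on the correction of one submodel: the variables it depends on and acts on,
  differentiability at the point of correction, and, for structure B, that \<open>fB\<close> describes the plant
  as a map of the submodel inputs (model consistency).
\<close>

primrec admissible_correction ::
  "(real ^ 'u) set \<Rightarrow> 'y set \<Rightarrow> ('u + 'y) set \<Rightarrow> (real ^ 'u \<Rightarrow> real ^ 'y)
    \<Rightarrow> (('u::finite, 'y::finite) io_vec \<Rightarrow> real ^ 'y) \<Rightarrow> real ^ 'u \<Rightarrow> ('u, 'y) correction \<Rightarrow> bool" where
  "admissible_correction U Yi Zi f\<^sub>p fB u\<^sub>k (Structure_A \<mu>) \<longleftrightarrow>
     coord_map UNIV Yi \<mu> \<and> \<mu> differentiable (at u\<^sub>k)"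
| "admissible_correction U Yi Zi f\<^sub>p fB u\<^sub>k (Structure_B \<mu>) \<longleftrightarrow>
     coord_map Zi Yi \<mu> \<and> \<mu> differentiable (at (plant_input Zi f\<^sub>p u\<^sub>k)) \<and>
     coord_map Zi Yi fB \<and> fB differentiable (at (plant_input Zi f\<^sub>p u\<^sub>k)) \<and>
     (\<forall>u\<in>U. plant_output Yi f\<^sub>p u = fB (plant_input Zi f\<^sub>p u))"

primrec corrected_to_first_order ::
  "'y set \<Rightarrow> ('u + 'y) set \<Rightarrow> (real ^ 'u \<Rightarrow> real ^ 'y) \<Rightarrow> (('u::finite, 'y::finite) io_vec \<Rightarrow> real ^ 'y)
    \<Rightarrow> (('u, 'y) io_vec \<Rightarrow> real ^ 'y) \<Rightarrow> real ^ 'u \<Rightarrow> ('u, 'y) correction \<Rightarrow> bool" where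
  "corrected_to_first_order Yi Zi f\<^sub>p fB fi u\<^sub>k (Structure_A \<mu>) \<longleftrightarrow>
     (let h = plant_input Zi f\<^sub>p; z = h u\<^sub>k; fA = plant_output Yi f\<^sub>p in
        fi z + \<mu> u\<^sub>k = fA u\<^sub>k \<and>
        nabla fi z ** nabla h u\<^sub>k + nabla \<mu> u\<^sub>k = nabla fA u\<^sub>k)"
| "corrected_to_first_order Yi Zi f\<^sub>p fB fi u\<^sub>k (Structure_B \<mu>) \<longleftrightarrow>
     (let h = plant_input Zi f\<^sub>p; z = h u\<^sub>k in
        fi z + \<mu> z = fB z \<and>
        (nabla fi z + nabla \<mu> z) ** nabla h u\<^sub>k = nabla fB z ** nabla h u\<^sub>k)"

definition correct_to_first_order ::
  "(real ^ 'u \<Rightarrow> real ^ 'y) \<Rightarrow> (real ^ 'u \<Rightarrow> real ^ 'y) \<Rightarrow> real ^ 'u \<Rightarrow> bool" where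
  "correct_to_first_order g f\<^sub>p u\<^sub>k \<longleftrightarrow> g u\<^sub>k = f\<^sub>p u\<^sub>k \<and> nabla g u\<^sub>k = nabla f\<^sub>p u\<^sub>k"

end

theory Submission
  imports Defs
begin

text \<open>
  Both the plant and the updated model solve the equation \<open>y u = F u (y u)\<close>, the plant to the first
  order at \<open>u\<^sub>k\<close> and the updated model on all of \<open>U\<close>, where \<open>F u y\<close> stacks the outputs of the corrected submodels. For the updated
  model this is the network itself. For the plant it is the sum over the submodels of the first-order
  conditions: each condition says that the corrected submodel, fed with the plant inputs
  \<open>h u = plant_input (Z i) f\<^sub>p u\<close>, reproduces the plant output and its gradient at \<open>u\<^sub>k\<close>
  (\<open>corrected_submodel_tracks_plant\<close>); in structure B the gradient of \<open>fB\<close> turns into that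
  of the plant output by model consistency and the chain rule.

  The values agree at \<open>u\<^sub>k\<close> because the plant outputs solve the network equations there and the
  solution is unique. Differentiating \<open>y u = F u (y u)\<close> along both solutions, the difference \<open>w\<close> of
  the two directional derivatives satisfies \<open>w = (\<partial>F/\<partial>y) w\<close>; regularity of the network is
  invertibility of \<open>1 - \<partial>F/\<partial>y\<close> and gives \<open>w = 0\<close> (\<open>first_order_solution_unique\<close>).
\<close>

lemma bounded_linear_restrict_coords: "bounded_linear (restrict_coords S)"
  unfolding linear_conv_bounded_linear[symmetric]
  by (rule linearI) (auto simp: restrict_coords_def vec_eq_iff)

lemma bounded_linear_sub_input:
  "bounded_linear (\<lambda>p :: (real ^ 'u::finite) \<times> (real ^ 'y::finite). sub_input Zi (fst p) (snd p))"
  unfolding linear_conv_bounded_linear[symmetric]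
  by (rule linearI)
    (auto simp: sub_input_def restrict_coords_def concat_vec_def vec_eq_iff split: sum.split)

lemma sum_restrict_coords_partition:
  fixes Y :: "'s::finite \<Rightarrow> 'y::finite set"
  assumes "disjoint_family Y" "(\<Union>i. Y i) = UNIV"
  shows "(\<Sum>i\<in>UNIV. restrict_coords (Y i) y) = y"
proof -
  have "(\<Sum>i\<in>UNIV. restrict_coords (Y i) y $ j) = y $ j" for j
  proof -
    obtain k where k: "j \<in> Y k"
      using assms(2) by blast
    have "j \<in> Y i \<longleftrightarrow> i = k" for i
      using k assms(1) by (auto simp: disjoint_family_on_def)
    then show ?thesis
      by (simp add: restrict_coords_def)
  qed
  then show ?thesis
    by (simp add: vec_eq_iff)
qed

text \<open>
  The uniqueness half of the implicit function theorem, to the first order: the hypotheses on \<open>g\<^sub>1\<close> and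
  \<open>g\<^sub>2\<close> linearize to \<open>L (v, D\<^sub>j v) = D\<^sub>j v\<close> with \<open>L\<close> the derivative of \<open>F\<close>, and subtracting
  them leaves \<open>D\<^sub>1 v - D\<^sub>2 v\<close> in the kernel of the derivative of \<open>y \<mapsto> y - F (a, y)\<close>.
\<close>

lemma first_order_solution_unique:
  fixes F :: "'a::real_normed_vector \<times> (real ^ 'n::finite) \<Rightarrow> real ^ 'n"
  assumes F: "F differentiable (at (a, b))"
    and regular: "invertible (nabla (\<lambda>y. y - F (a, y)) b)"
    and g1: "(g\<^sub>1 has_derivative D\<^sub>1) (at a)" "g\<^sub>1 a = b" "((\<lambda>u. F (u, g\<^sub>1 u)) has_derivative D\<^sub>1) (at a)"
    and g2: "(g\<^sub>2 has_derivative D\<^sub>2) (at a)" "g\<^sub>2 a = b" "((\<lambda>u. F (u, g\<^sub>2 u)) has_derivative D\<^sub>2) (at a)"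
  shows "D\<^sub>1 = D\<^sub>2"
proof
  fix v
  obtain L where L: "(F has_derivative L) (at (a, b))"
    using F by (auto simp: differentiable_def)
  have linearized: "D v = L (v, D v)"
    if "(g has_derivative D) (at a)" "g a = b" "((\<lambda>u. F (u, g u)) has_derivative D) (at a)" for g D
  proof -
    have "((\<lambda>u. F (u, g u)) has_derivative (\<lambda>v. L (v, D v))) (at a)"
      using has_derivative_compose[OF has_derivative_Pair[OF has_derivative_ident that(1)], of F L] L that(2)
      by simp
    then have "D = (\<lambda>v. L (v, D v))"
      by (rule has_derivative_unique[OF that(3)])
    then show ?thesis
      by (rule fun_cong)
  qed
  let ?w = "D\<^sub>1 v - D\<^sub>2 v"
  have "?w = L ((v, D\<^sub>1 v) - (v, D\<^sub>2 v))"
    using linearized[OF g1] linearized[OF g2]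
    by (simp only: linear_diff[OF has_derivative_linear[OF L]])
  then have kernel: "?w = L (0, ?w)"
    by simp
  let ?J = "nabla (\<lambda>y. y - F (a, y)) b"
  have "((\<lambda>y. F (a, y)) has_derivative (\<lambda>w. L (0, w))) (at b)"
    using has_derivative_compose[OF has_derivative_Pair[OF has_derivative_const has_derivative_ident], of F L a b UNIV] L
    by simp
  then have "((\<lambda>y. y - F (a, y)) has_derivative (\<lambda>w. w - L (0, w))) (at b)"
    by (intro has_derivative_diff has_derivative_ident)
  moreover from this have "((\<lambda>y. y - F (a, y)) has_derivative (\<lambda>w. ?J *v w)) (at b)"
    using jacobian_works differentiable_def by blast
  ultimately have "(\<lambda>w. w - L (0, w)) = (\<lambda>w. ?J *v w)"
    by (rule has_derivative_unique)
  then have "?J *v ?w = ?w - L (0, ?w)"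
    by (rule fun_cong[symmetric])
  then have "?J *v ?w = 0"
    using kernel by simp
  then have "?w = 0"
    using regular by (metis invertible_def matrix_left_invertible_ker)
  then show "D\<^sub>1 v = D\<^sub>2 v"
    by simp
qed

lemma differentiable_sub_input_compose:
  fixes g :: "('u::finite, 'y::finite) io_vec \<Rightarrow> 'a::real_normed_vector"
  assumes "g differentiable (at (sub_input Zi u y))"
  shows "(\<lambda>p. g (sub_input Zi (fst p) (snd p))) differentiable (at (u, y))"
  using differentiable_chain_at[OF bounded_linear_imp_differentiable[OF bounded_linear_sub_input], of g Zi "(u, y)"]
    assms
  by (simp add: o_def)

lemma differentiable_corrected:
  assumes fi: "fi differentiable (at (plant_input Zi f\<^sub>p u\<^sub>k))"
    and c: "admissible_correction U Yi Zi f\<^sub>p fB u\<^sub>k c"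
  shows "(\<lambda>p. corrected fi c (fst p) (sub_input Zi (fst p) (snd p))) differentiable (at (u\<^sub>k, f\<^sub>p u\<^sub>k))"
proof (cases c)
  case (Structure_A \<mu>)
  have "(\<lambda>p. \<mu> (fst p)) differentiable (at (u\<^sub>k, f\<^sub>p u\<^sub>k))"
    using differentiable_chain_at[OF bounded_linear_imp_differentiable[OF bounded_linear_fst], of \<mu> "(u\<^sub>k, f\<^sub>p u\<^sub>k)"]
      c Structure_A by (simp add: o_def)
  then show ?thesis
    using fi Structure_A by (simp add: plant_input_def differentiable_sub_input_compose)
next
  case (Structure_B \<mu>)
  then show ?thesis
    using fi c by (simp add: plant_input_def differentiable_sub_input_compose)
qed

lemma has_derivative_plant_input:
  fixes f\<^sub>p :: "real ^ 'u::finite \<Rightarrow> real ^ 'y::finite"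
  assumes "f\<^sub>p differentiable (at u)"
  shows "(plant_input Zi f\<^sub>p has_derivative (\<lambda>v. nabla (plant_input Zi f\<^sub>p) u *v v)) (at u)"
proof -
  obtain D where D: "(f\<^sub>p has_derivative D) (at u)"
    using assms by (auto simp: differentiable_def)
  have "((\<lambda>u. sub_input Zi u (f\<^sub>p u)) has_derivative (\<lambda>v. sub_input Zi v (D v))) (at u)"
    using bounded_linear.has_derivative[OF bounded_linear_sub_input has_derivative_Pair[OF has_derivative_ident D]]
    by simp
  then have "plant_input Zi f\<^sub>p differentiable (at u)"
    unfolding plant_input_def differentiable_def by blast
  then show ?thesis
    using jacobian_works by blast
qed

text \<open>
  The common content of the two first-order conditions: fed with the plant inputs, the corrected
  submodel has the value and the derivative of the plant output at \<open>u\<^sub>k\<close>. The matrix products in the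
  conditions are the chain rule for the composition with the plant inputs. In structure B it gives
  the derivative of \<open>u \<mapsto> fB (plant_input Zi f\<^sub>p u)\<close>, which is the plant output on the whole of the open set \<open>U\<close>.
\<close>

lemma corrected_submodel_tracks_plant:
  fixes f\<^sub>p :: "real ^ 'u::finite \<Rightarrow> real ^ 'y::finite"
  assumes U: "open U" "u\<^sub>k \<in> U"
    and D: "(f\<^sub>p has_derivative D) (at u\<^sub>k)"
    and fi: "fi differentiable (at (plant_input Zi f\<^sub>p u\<^sub>k))"
    and adm: "admissible_correction U Yi Zi f\<^sub>p fB u\<^sub>k c"
    and corr: "corrected_to_first_order Yi Zi f\<^sub>p fB fi u\<^sub>k c"
  shows "corrected fi c u\<^sub>k (plant_input Zi f\<^sub>p u\<^sub>k) = restrict_coords Yi (f\<^sub>p u\<^sub>k)"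
    and "((\<lambda>u. corrected fi c u (plant_input Zi f\<^sub>p u)) has_derivative (\<lambda>v. restrict_coords Yi (D v))) (at u\<^sub>k)"
proof -
  let ?h = "plant_input Zi f\<^sub>p"
  have h: "(?h has_derivative (\<lambda>v. nabla ?h u\<^sub>k *v v)) (at u\<^sub>k)"
    using D by (intro has_derivative_plant_input) (auto simp: differentiable_def)
  have along_plant: "((\<lambda>u. g (?h u)) has_derivative (\<lambda>v. (nabla g (?h u\<^sub>k) ** nabla ?h u\<^sub>k) *v v)) (at u\<^sub>k)"
    if "g differentiable (at (?h u\<^sub>k))" for g :: "('u, 'y) io_vec \<Rightarrow> real ^ 'y"
    using has_derivative_compose[OF h that[unfolded jacobian_works]]
    by (simp add: matrix_vector_mul_assoc)
  have out: "(plant_output Yi f\<^sub>p has_derivative (\<lambda>v. restrict_coords Yi (D v))) (at u\<^sub>k)"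
    unfolding plant_output_def
    by (rule bounded_linear.has_derivative[OF bounded_linear_restrict_coords D])
  then have nabla_out: "(\<lambda>v. nabla (plant_output Yi f\<^sub>p) u\<^sub>k *v v) = (\<lambda>v. restrict_coords Yi (D v))"
    by (metis differentiable_def has_derivative_unique jacobian_works)
  have "corrected fi c u\<^sub>k (?h u\<^sub>k) = restrict_coords Yi (f\<^sub>p u\<^sub>k) \<and>
    ((\<lambda>u. corrected fi c u (?h u)) has_derivative (\<lambda>v. restrict_coords Yi (D v))) (at u\<^sub>k)"
  proof (cases c)
    case (Structure_A \<mu>)
    have "(\<mu> has_derivative (\<lambda>v. nabla \<mu> u\<^sub>k *v v)) (at u\<^sub>k)"
      using adm Structure_A jacobian_works by auto
    from has_derivative_add[OF along_plant[OF fi] this]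
    have "((\<lambda>u. fi (?h u) + \<mu> u) has_derivative
        (\<lambda>v. (nabla fi (?h u\<^sub>k) ** nabla ?h u\<^sub>k + nabla \<mu> u\<^sub>k) *v v)) (at u\<^sub>k)"
      by (simp add: matrix_vector_mult_add_rdistrib)
    then show ?thesis
      using corr Structure_A nabla_out by (simp add: Let_def plant_output_def)
  next
    case (Structure_B \<mu>)
    have \<mu>: "\<mu> differentiable (at (?h u\<^sub>k))" and fB: "fB differentiable (at (?h u\<^sub>k))"
      and consistent: "\<And>u. u \<in> U \<Longrightarrow> fB (?h u) = plant_output Yi f\<^sub>p u"
      using adm Structure_B by auto
    have "(plant_output Yi f\<^sub>p has_derivative (\<lambda>v. (nabla fB (?h u\<^sub>k) ** nabla ?h u\<^sub>k) *v v)) (at u\<^sub>k)"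
      using has_derivative_transform_within_open[OF along_plant[OF fB] U consistent] .
    then have nabla_fB: "(\<lambda>v. (nabla fB (?h u\<^sub>k) ** nabla ?h u\<^sub>k) *v v) = (\<lambda>v. restrict_coords Yi (D v))"
      using out by (rule has_derivative_unique)
    from has_derivative_add[OF along_plant[OF fi] along_plant[OF \<mu>]]
    have "((\<lambda>u. fi (?h u) + \<mu> (?h u)) has_derivative
        (\<lambda>v. ((nabla fi (?h u\<^sub>k) + nabla \<mu> (?h u\<^sub>k)) ** nabla ?h u\<^sub>k) *v v)) (at u\<^sub>k)"
      by (simp add: matrix_vector_mult_add_rdistrib flip: matrix_vector_mul_assoc)
    then show ?thesis
      using corr Structure_B nabla_fB consistent[OF U(2)] by (simp add: Let_def plant_output_def)
  qed
  then show "corrected fi c u\<^sub>k (plant_input Zi f\<^sub>p u\<^sub>k) = restrict_coords Yi (f\<^sub>p u\<^sub>k)"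
    and "((\<lambda>u. corrected fi c u (plant_input Zi f\<^sub>p u)) has_derivative (\<lambda>v. restrict_coords Yi (D v))) (at u\<^sub>k)"
    by auto
qed

theorem theorem5p2:
  fixes f\<^sub>p :: "real ^ 'u::finite \<Rightarrow> real ^ 'y::finite"  \<comment> \<open>plant\<close>
    and f :: "real ^ 'u \<Rightarrow> real ^ 'y"  \<comment> \<open>model\<close>
    and f\<^sub>k :: "real ^ 'u \<Rightarrow> real ^ 'y"  \<comment> \<open>updated model\<close>
    and Y :: "'s::finite \<Rightarrow> 'y set"
    and Z :: "'s \<Rightarrow> ('u + 'y) set"
    and fs :: "'s \<Rightarrow> ('u, 'y) io_vec \<Rightarrow> real ^ 'y"  \<comment> \<open>submodels\<close>
    and fB :: "'s \<Rightarrow> ('u, 'y) io_vec \<Rightarrow> real ^ 'y"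
    and c :: "'s \<Rightarrow> ('u, 'y) correction"
    and U :: "(real ^ 'u) set" and u\<^sub>k :: "real ^ 'u"
  assumes U: "open U" "u\<^sub>k \<in> U"
    and outputs: "disjoint_family Y" "(\<Union>i. Y i) = UNIV"
    and plant_diff: "f\<^sub>p differentiable (at u\<^sub>k)"
    and submodels: "\<And>i. coord_map (Z i) (Y i) (fs i)"
    and submodels_diff: "\<And>i. fs i differentiable (at (plant_input (Z i) f\<^sub>p u\<^sub>k))"
    and model: "network_solution U Y Z (\<lambda>i u z. fs i z) f"
    and corrections: "\<And>i. admissible_correction U (Y i) (Z i) f\<^sub>p (fB i) u\<^sub>k (c i)"
    and corrected: "\<And>i. corrected_to_first_order (Y i) (Z i) f\<^sub>p (fB i) (fs i) u\<^sub>k (c i)"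
    and updated_model: "network_solution U Y Z (\<lambda>i. corrected (fs i) (c i)) f\<^sub>k"
    and updated_regular: "network_regular Z (\<lambda>i. corrected (fs i) (c i)) u\<^sub>k (f\<^sub>k u\<^sub>k)"
    and updated_diff: "f\<^sub>k differentiable (at u\<^sub>k)"
  shows "correct_to_first_order f\<^sub>k f\<^sub>p u\<^sub>k"
proof -
  let ?G = "\<lambda>i. corrected (fs i) (c i)"
  let ?F = "\<lambda>p. \<Sum>i\<in>UNIV. ?G i (fst p) (sub_input (Z i) (fst p) (snd p))"
  obtain D where D: "(f\<^sub>p has_derivative D) (at u\<^sub>k)"
    using plant_diff by (auto simp: differentiable_def)
  obtain D\<^sub>k where D\<^sub>k: "(f\<^sub>k has_derivative D\<^sub>k) (at u\<^sub>k)"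
    using updated_diff by (auto simp: differentiable_def)
  note tracks = corrected_submodel_tracks_plant[OF U D submodels_diff corrections corrected]

  have "network_eqs Y Z ?G u\<^sub>k (f\<^sub>p u\<^sub>k)"
    using tracks(1) by (simp add: network_eqs_def plant_input_def)
  then have value_eq: "f\<^sub>k u\<^sub>k = f\<^sub>p u\<^sub>k"
    using updated_model U(2) by (simp add: network_solution_def)

  have plant_solves: "((\<lambda>u. ?F (u, f\<^sub>p u)) has_derivative D) (at u\<^sub>k)"
    using has_derivative_sum[of UNIV, OF tracks(2), of "\<lambda>i. i"]
    by (simp add: plant_input_def sum_restrict_coords_partition[OF outputs])

  have "f\<^sub>k u = ?F (u, f\<^sub>k u)" if "u \<in> U" for u
  proof -
    have "network_eqs Y Z ?G u (f\<^sub>k u)"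
      using updated_model that by (simp add: network_solution_def)
    then have "?F (u, f\<^sub>k u) = (\<Sum>i\<in>UNIV. restrict_coords (Y i) (f\<^sub>k u))"
      by (simp add: network_eqs_def)
    then show ?thesis
      by (simp add: sum_restrict_coords_partition[OF outputs])
  qed
  from has_derivative_transform_within_open[OF D\<^sub>k U this]
  have model_solves: "((\<lambda>u. ?F (u, f\<^sub>k u)) has_derivative D\<^sub>k) (at u\<^sub>k)" .

  have "?F differentiable (at (u\<^sub>k, f\<^sub>p u\<^sub>k))"
    by (intro differentiable_sum ballI differentiable_corrected[OF submodels_diff corrections]) simp
  moreover have "invertible (nabla (\<lambda>y. y - ?F (u\<^sub>k, y)) (f\<^sub>p u\<^sub>k))"
    using updated_regular by (simp add: network_regular_def value_eq)
  ultimately have "D\<^sub>k = D"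
    by (rule first_order_solution_unique[OF _ _ D\<^sub>k value_eq model_solves D refl plant_solves])
  then have "nabla f\<^sub>k u\<^sub>k = nabla f\<^sub>p u\<^sub>k"
    using frechet_derivative_at[OF D\<^sub>k] frechet_derivative_at[OF D] by (simp add: jacobian_def)
  then show ?thesis
    using value_eq by (simp add: correct_to_first_order_def)
qed

end
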